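(* The time complexity of the quantum $N$-Queens algorithm $\mathcal{A}_N$ (described in the context) is of the order $\mathcal{O}(N^3)$: the number of elementary gates (Hadamard, controlled phase shift by $e^{i\pi}$, and Toffoli gates) used by $\mathcal{A}_N$, as a function of $N\in\mathbb{N}$, is $\mathcal{O}(N^3)$ as $N\to\infty$.
   Context: The time complexity of a quantum algorithm is the limiting behaviour, as $N\to\infty$, of the number of elementary operations (gates) it requires as a function of the input size $N$. The algorithm $\mathcal{A}_N$ acts on $N^2$ system qubits together with $N-1$ column ancillas and $\frac{N(N-1)}{2}$ diagonal ancillas. The system qubits are denoted $q_{xy}$, $x,y\in\{1,\dots,N\}$, where $q_{xy}$ is the $y$-th qubit of the $x$-th block and corresponds to the square in row $x$ and column $y$ of an $N\times N$ chessboard ($1$ = queen, $0$ = vacant). Before the algorithm starts, the system is supplied in the state $|\Psi\rangle=|\psi_1\rangle\otimes\cdots\otimes|\psi_N\rangle$, where each block $|\psi_i\rangle$ is the $N$-qubit $W$ state $\frac{1}{\sqrt N}\sum_{r=1}^{N}|R_r\rangle$ with $R_r$ the $r$-th row of the $N\times N$ identity matrix; this preparation is not part of the algorithm. The column ancillas $c_1,\dots,c_{N-1}$ are supplied in the state $|0\rangle$ and the diagonal ancillas $\delta_1,\dots,\delta_{N(N-1)/2}$ in the state $|1\rangle$. The gates of $\mathcal{A}_N$ are the following. (1) Column checks. For each $y\in\{1,\dots,N-1\}$: apply a Hadamard gate to $c_y$; then for each $x\in\{1,\dots,N\}$ apply a controlled phase shift $e^{i\pi}$ (controlled-$Z$)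 with control $c_y$ and target $q_{xy}$; then apply a Hadamard gate to $c_y$ again. (2) Diagonal checks. For all $i,j,x,y\in\{1,\dots,N\}$ with $j>i$ such that the squares $(i,x)$ and $(j,y)$ (row, column) lie on a common diagonal, i.e. $|x-y|=j-i$: apply a Toffoli gate with controls $q_{ix}$ and $q_{jy}$ and target $\delta_k$, where $k=\frac{(i-1)}{2}(2N-i)+(j-i)$. *)

theory Defs
  imports Complex_Main "HOL-Library.Landau_Symbols"
begin

datatype qubit =
    Square nat nat  \<comment> \<open>\<open>Square x y\<close>: the \<open>y\<close>-th qubit of the \<open>x\<close>-th block, i.e. row \<open>x\<close>, column \<open>y\<close>\<close>
  | Column_Ancilla nat
  | Diagonal_Ancilla nat

datatype gate =
    Hadamard qubit
  | Controlled_Phase real qubit qubit  \<comment> \<open>angle, control, target\<close>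
  | Toffoli qubit qubit qubit  \<comment> \<open>two controls, target\<close>

text \<open>A computational basis state assigns a bit to every qubit (\<open>True\<close> is 1), and a state is its
  family of amplitudes. The states of a finite register are those that vanish on every
  assignment in which a qubit outside the register is 1.\<close>

type_synonym basis_state = "qubit \<Rightarrow> bool"
type_synonym state = "basis_state \<Rightarrow> complex"

primrec apply_gate :: "gate \<Rightarrow> state \<Rightarrow> state" where
  "apply_gate (Hadamard q) \<psi> =
     (\<lambda>b. (\<psi> (b(q := False)) + (if b q then - 1 else 1) * \<psi> (b(q := True))) / complex_of_real (sqrt 2))"
| "apply_gate (Controlled_Phase \<theta> c t) \<psi> =
     (\<lambda>b. (if b c \<and> b t then cis \<theta> else 1) * \<psi> b)"
| "apply_gate (Toffoli c1 c2 t) \<psi> =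
     (\<lambda>b. \<psi> (b(t := (b t \<noteq> (b c1 \<and> b c2)))))"

record quantum_algorithm =
  qubits :: "qubit set"
  supplied_state :: state
  gates :: "gate list"  \<comment> \<open>in order of application\<close>

definition output_state :: "quantum_algorithm \<Rightarrow> state" where
  "output_state A = fold apply_gate (gates A) (supplied_state A)"

definition time_complexity :: "quantum_algorithm \<Rightarrow> nat" where
  "time_complexity A = length (gates A)"

definition square_qubits :: "nat \<Rightarrow> qubit set" where
  "square_qubits N = {Square x y | x y. x \<in> {1..N} \<and> y \<in> {1..N}}"

definition column_ancillas :: "nat \<Rightarrow> qubit set" where
  "column_ancillas N = Column_Ancilla ` {1..N - 1}"

definition diagonal_ancillas :: "nat \<Rightarrow> qubit set" where
  "diagonal_ancillas N = Diagonal_Ancilla ` {1..N * (N - 1) div 2}"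

definition W_amplitude :: "nat \<Rightarrow> (nat \<Rightarrow> bool) \<Rightarrow> complex" where
  "W_amplitude N v =
     (1 / complex_of_real (sqrt (real N))) *
     (\<Sum>r = 1..N. if \<forall>y \<in> {1..N}. v y \<longleftrightarrow> y = r then 1 else 0)"

definition queens_supplied_state :: "nat \<Rightarrow> state" where
  "queens_supplied_state N b =
     (if (\<forall>q \<in> column_ancillas N. \<not> b q) \<and> (\<forall>q \<in> diagonal_ancillas N. b q) \<and>
         (\<forall>q. q \<notin> square_qubits N \<union> column_ancillas N \<union> diagonal_ancillas N \<longrightarrow> \<not> b q)
      then \<Prod>x = 1..N. W_amplitude N (\<lambda>y. b (Square x y))
      else 0)"

definition column_check :: "nat \<Rightarrow> nat \<Rightarrow> gate list" where
  "column_check N y =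
     [Hadamard (Column_Ancilla y)]
     @ [Controlled_Phase pi (Column_Ancilla y) (Square x y). x \<leftarrow> [1..<N + 1]]
     @ [Hadamard (Column_Ancilla y)]"

definition column_checks :: "nat \<Rightarrow> gate list" where
  "column_checks N = concat [column_check N y. y \<leftarrow> [1..<N]]"

text \<open>The division by 2 is exact, because \<open>i - 1\<close> or \<open>2 * N - i\<close> is even.\<close>

definition diagonal_index :: "nat \<Rightarrow> nat \<Rightarrow> nat \<Rightarrow> nat" where
  "diagonal_index N i j = (i - 1) * (2 * N - i) div 2 + (j - i)"

text \<open>The diagonal checks come with no prescribed order. They commute pairwise, since all their
  controls are square qubits and all their targets are ancillas; here they are listed
  lexicographically.\<close>

definition diagonal_checks :: "nat \<Rightarrow> gate list" where
  "diagonal_checks N =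
     [Toffoli (Square i x) (Square j y) (Diagonal_Ancilla (diagonal_index N i j)).
        i \<leftarrow> [1..<N + 1], j \<leftarrow> [1..<N + 1], x \<leftarrow> [1..<N + 1], y \<leftarrow> [1..<N + 1],
        j > i \<and> \<bar>int x - int y\<bar> = int j - int i]"

definition queens_algorithm :: "nat \<Rightarrow> quantum_algorithm" where
  "queens_algorithm N =
     \<lparr>qubits = square_qubits N \<union> column_ancillas N \<union> diagonal_ancillas N,
      supplied_state = queens_supplied_state N,
      gates = column_checks N @ diagonal_checks N\<rparr>"

end

theory Submission
  imports Defs
begin

text \<open>The column checks use \<open>(N - 1) (N + 2)\<close> gates. For the diagonal checks, the rows \<open>i < j\<close> and
  the column \<open>x\<close> determine the column \<open>y\<close> up to the two choices \<open>x \<plusminus> (j - i)\<close>, so there are at most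
  \<open>2 N\<^sup>3\<close> of them.\<close>

text \<open>Peels one generator off a nested list comprehension, so that each loop contributes one
  factor.\<close>

lemma length_concat_map_le:
  assumes "\<And>x. x \<in> set xs \<Longrightarrow> length (f x) \<le> c"
  shows "length (concat (map f xs)) \<le> length xs * c"
  using assms by (induction xs) (auto intro: add_mono)

text \<open>This is the form to which an innermost generator followed by a condition
  unfolds.\<close>

lemma length_concat_map_if:
  "length (concat (map (\<lambda>x. if P x then [f x] else []) xs)) = length (filter P xs)"
  by (induction xs) auto

lemma length_filter_abs_diff_eq_le:
  fixes x :: nat and d :: int
  assumes "distinct ys"
  shows "length (filter (\<lambda>y. \<bar>int x - int y\<bar> = d) ys) \<le> 2"
proof -
  have "length (filter (\<lambda>y. \<bar>int x - int y\<bar> = d) ys)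
      = card (set (filter (\<lambda>y. \<bar>int x - int y\<bar> = d) ys))"
    using assms by (intro distinct_card[symmetric] distinct_filter)
  \<comment> \<open>Where \<open>nat\<close> truncates a negative value to 0, the set merely gains a
    spare element, harmless for an upper bound.\<close>
  also have "\<dots> \<le> card {nat (int x + d), nat (int x - d)}"
    by (rule card_mono) auto
  also have "\<dots> \<le> 2"
    by (simp add: card_insert_if)
  finally show ?thesis .
qed

text \<open>Each column has \<open>N\<close> phase gates between two Hadamard gates.\<close>

lemma length_column_checks: "length (column_checks N) = (N - 1) * (N + 2)"
  by (simp add: column_checks_def column_check_def length_concat comp_def
      map_replicate_const sum_list_replicate)

lemma length_diagonal_checks_le: "length (diagonal_checks N) \<le> 2 * N ^ 3"
proof -
  let ?I = "[1..<N + 1]"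
  have "length (filter (\<lambda>y. j > i \<and> \<bar>int x - int y\<bar> = int j - int i) ?I) \<le> 2" for i j x :: nat
    using length_filter_abs_diff_eq_le[of ?I x "int j - int i"] by (cases "j > i") simp_all
  \<comment> \<open>The three outer factors count \<open>i\<close>, \<open>j\<close> and
    \<open>x\<close>; the 2 bounds the choices of \<open>y\<close>.\<close>
  then have "length (diagonal_checks N) \<le> length ?I * (length ?I * (length ?I * 2))"
    unfolding diagonal_checks_def
    by (intro length_concat_map_le) (simp only: length_concat_map_if)
  then show ?thesis
    by (simp add: power3_eq_cube mult_ac del: upt_Suc)
qed

lemma time_complexity_queens_algorithm_le: "time_complexity (queens_algorithm N) \<le> 5 * N ^ 3"
proof (cases "N = 0")
  case True
  then show ?thesis
    by (simp add: time_complexity_def queens_algorithm_def column_checks_def diagonal_checks_def)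
next
  case False
  \<comment> \<open>The factorwise bound \<open>N + 2 \<le> 3 * N\<close> fails at
    \<open>N = 0\<close>, hence the case split.\<close>
  have "(N - 1) * (N + 2) \<le> N * (3 * N)"
    using False by (intro mult_mono) auto
  also have "\<dots> \<le> 3 * N ^ 3"
    using False by (simp add: power3_eq_cube)
  finally show ?thesis
    using length_diagonal_checks_le[of N]
    by (simp add: time_complexity_def queens_algorithm_def length_column_checks)
qed

theorem proposition2:
  "(\<lambda>N::nat. real (time_complexity (queens_algorithm N))) \<in> O(\<lambda>N. real N ^ 3)"
proof (rule bigoI[where c = 5], rule always_eventually, rule allI)
  fix N :: nat
  have "real (time_complexity (queens_algorithm N)) \<le> real (5 * N ^ 3)"
    using time_complexity_queens_algorithm_le by (simp only: of_nat_le_iff)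
  then show "norm (real (time_complexity (queens_algorithm N))) \<le> 5 * norm (real N ^ 3)"
    by simp
qed

end
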